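(* Let $G$ be a connected graph with $e\ge 2$ edges and $\chi_{la}(G)=t\ge 2$, and let $f$, $V_1,\dots,V_t$, $n_1,\dots,n_t$, $c_1,\dots,c_t$, $r$, $b$ and $G(V_i,s)$ be as defined in the context. Let $r\ge 2$. For an index $i$ with $1\le i\le r$, let $s$ be an integer with $$e+sn_i\ge \begin{cases} c_r & \text{for } i<r,\\ c_{r-1} & \text{for } i=r,\end{cases}$$ such that $s\ge 1$ if $n_i=1$, and $s\ge 2$ is even if $n_i\ge 2$. (These conditions on $s$ are assumed for each graph $G(V_i,s)$ appearing below.) (1) Suppose $e<c_1$. For $1\le i\le r$, $\chi_{la}(G(V_i,s))=sn_i+t-r+1$. (2) Suppose $c_1\le e<c_2$. Then $\chi_{la}(G(V_1,s))=sn_1+t-r+1$. For $2\le i\le r$, $sn_i+t-r+b+1\le \chi_{la}(G(V_i,s))\le sn_i+t-r+2$. Moreover, if $c_1=e$ and $b=1$, then $\chi_{la}(G(V_i,s))=sn_i+t-r+2$ for $2\le i\le r$. (3) Suppose $c_{j-1}\le e<c_j$ for some $j$ with $3\le j\le r$. Then (a) $sn_i+t-r+b\le \chi_{la}(G(V_i,s))\le sn_i+t-r+j-1$ for $1\le i\le j-1$, if $V_i$ has a pendant vertex; (b) $sn_i+t-r+b+1\le \chi_{la}(G(V_i,s))\le sn_i+t-r+j-1$ for $1\le i\le j-1$, if $V_i$ has no pendant vertex; (c) $sn_i+t-r+b+1\le \chi_{la}(G(V_i,s))\le sn_i+t-r+j$ for $j\le i\le r$. Moreover, when $c_{j-1}=e$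 and $b=j-1$, $\chi_{la}(G(V_i,s))=sn_i+t-r+j-1$ for $1\le i\le j-1$, and $\chi_{la}(G(V_i,s))=sn_i+t-r+j$ for $j\le i\le r$. In particular, if $c_{r-1}\le e<c_r$, then for $G(V_r,s)$ the condition on $e+sn_r$ simplifies to: $s\ge 1$ if $n_r=1$, and $s\ge 2$ is even if $n_r\ge 2$.
   Context: Graphs are finite and simple. Let $G=(V,E)$ be a connected graph of order at least 3. A local antimagic labeling of $G$ is a bijection $f:E\to\{1,\dots,|E|\}$ such that the induced vertex labeling $f^+(u)=\sum f(\varepsilon)$ (sum over all edges $\varepsilon$ incident to $u$) satisfies $f^+(x)\ne f^+(y)$ for every pair of adjacent vertices $x,y$. Let $c(f)$ be the number of distinct values of $f^+$. The local antimagic chromatic number is $\chi_{la}(G)=\min\{c(f): f \text{ is a local antimagic labeling of } G\}$. A pendant vertex is a vertex of degree 1; a pendant edge is an edge incident to a pendant vertex. Setting. $G$ is a connected graph with $e\ge 2$ edges ($e$ denotes the number of edges) and $\chi_{la}(G)=t\ge 2$. Let $f$ be a local antimagic labeling of $G$ with $c(f)=t$; its color classes form a partition of $V(G)$ into $t$ independent sets $V_1,\dots,V_t$ with $|V_i|=n_i\ge 1$, and $f^+(v)=c_i$ for each $v\in V_i$, where $c_1,\dots,c_t$ are distinct. The integer $r$, $1\le r\le t$, is such that each non-pendant vertex of $G$ belongs to one of $V_1,\dots,V_r$ and, if $r<t$, each $V_i$ with $r+1\le i\le t$ is a singleton consisting of a pendant vertex. The classes are indexed so that $c_1<c_2<\cdots<c_r$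 and $c_{r+1}<c_{r+2}<\cdots<c_t$ (if $r=t$, the numbers $c_{r+1},\dots,c_t$ do not exist). Let $b\ge 0$ be the number of pendant vertices of $G$ in $\bigcup_{i=1}^r V_i$, so $G$ has exactly $t-r+b$ pendant vertices. For $1\le i\le t$, write $V_i=\{v_a: 1\le a\le n_i\}$. $G(V_i,s)$ denotes the graph obtained from $G$ by adding $s$ pendant edges $v_aw_{a,k}$ ($1\le k\le s$), with new distinct vertices $w_{a,k}$, to each vertex $v_a\in V_i$. *)

theory Defs
  imports Main "HOL-Library.Disjoint_Sets"
begin

record 'a ugraph =
  vertices :: "'a set"
  edges :: "'a set set"

definition simple_graph :: "'a ugraph \<Rightarrow> bool" where
  "simple_graph G \<longleftrightarrow> finite (vertices G) \<and>
     (\<forall>\<epsilon>\<in>edges G. \<epsilon> \<subseteq> vertices G \<and> card \<epsilon> = 2)"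

definition connected_graph :: "'a ugraph \<Rightarrow> bool" where
  "connected_graph G \<longleftrightarrow> vertices G \<noteq> {} \<and>
     (\<forall>u\<in>vertices G. \<forall>v\<in>vertices G. (u, v) \<in> {(x, y). {x, y} \<in> edges G}\<^sup>*)"

definition incident_edges :: "'a ugraph \<Rightarrow> 'a \<Rightarrow> 'a set set" where
  "incident_edges G v = {\<epsilon> \<in> edges G. v \<in> \<epsilon>}"

definition pendant :: "'a ugraph \<Rightarrow> 'a \<Rightarrow> bool" where
  "pendant G v \<longleftrightarrow> v \<in> vertices G \<and> card (incident_edges G v) = 1"

definition independent :: "'a ugraph \<Rightarrow> 'a set \<Rightarrow> bool" where
  "independent G S \<longleftrightarrow> S \<subseteq> vertices G \<and> (\<forall>x\<in>S. \<forall>y\<in>S. {x, y} \<notin> edges G)"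

definition induced_label :: "'a ugraph \<Rightarrow> ('a set \<Rightarrow> nat) \<Rightarrow> 'a \<Rightarrow> nat" where
  "induced_label G f u = (\<Sum>\<epsilon>\<in>incident_edges G u. f \<epsilon>)"

definition local_antimagic :: "'a ugraph \<Rightarrow> ('a set \<Rightarrow> nat) \<Rightarrow> bool" where
  "local_antimagic G f \<longleftrightarrow> bij_betw f (edges G) {1..card (edges G)} \<and>
     (\<forall>x y. {x, y} \<in> edges G \<longrightarrow> induced_label G f x \<noteq> induced_label G f y)"

definition num_colors :: "'a ugraph \<Rightarrow> ('a set \<Rightarrow> nat) \<Rightarrow> nat" where
  "num_colors G f = card (induced_label G f ` vertices G)"

(* A minimum, since every nonempty set of naturals contains its infimum; the value is 0
   if G has no local antimagic labeling. A positive lower bound on this number for a graph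
   therefore includes the existence of a labeling. *)
definition chi_la :: "'a ugraph \<Rightarrow> nat" where
  "chi_la G = Inf {num_colors G f | f. local_antimagic G f}"

(* G(S,s): the old vertex v becomes Inl v, and Inr (v, k) is the k-th new
   pendant vertex attached to v. *)
definition add_pendants :: "'a ugraph \<Rightarrow> 'a set \<Rightarrow> nat \<Rightarrow> ('a + 'a \<times> nat) ugraph" where
  "add_pendants G S s = \<lparr>
     vertices = Inl ` vertices G \<union> Inr ` (S \<times> {1..s}),
     edges = (\<lambda>\<epsilon>. Inl ` \<epsilon>) ` edges G \<union> {{Inl v, Inr (v, k)} | v k. v \<in> S \<and> k \<in> {1..s}} \<rparr>"

definition size_parity :: "nat \<Rightarrow> nat \<Rightarrow> bool" where
  "size_parity m s \<longleftrightarrow> (m = 1 \<longrightarrow> s \<ge> 1) \<and> (m \<ge> 2 \<longrightarrow> s \<ge> 2 \<and> even s)"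

definition admissible ::
  "nat \<Rightarrow> (nat \<Rightarrow> nat) \<Rightarrow> (nat \<Rightarrow> nat) \<Rightarrow> nat \<Rightarrow> nat \<Rightarrow> nat \<Rightarrow> bool" where
  "admissible e n c r i s \<longleftrightarrow>
     e + s * n i \<ge> (if i < r then c r else c (r - 1)) \<and> size_parity (n i) s"

end

theory Submission
  imports Defs
begin

text \<open>
  Every bound comes from one construction and one obstruction.

  Upper bound (\<open>extend_labeling\<close>): keep \<open>f\<close> on the old edges and give the new pendant edges the
  labels above \<open>e\<close>. If every vertex of \<open>V\<^sub>i\<close> receives the same total of new labels, then \<open>V\<^sub>i\<close>
  stays monochromatic, and such a distribution exists when \<open>V\<^sub>i\<close> is a singleton or \<open>s\<close> is even
  (\<open>snake_numbering\<close>). The new pendant vertices show all the colors \<open>e + 1, \<dots>, e + s n\<^sub>i\<close>, and the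
  color of \<open>V\<^sub>i\<close> rises above \<open>e + s n\<^sub>i\<close>. The condition \<open>e + s n\<^sub>i \<ge> c\<^sub>r\<close> (or \<open>c\<^bsub>r-1\<^esub>\<close>) places
  every other old color below the new color of \<open>V\<^sub>i\<close>, so that the labeling is proper, and it also
  makes each old color above \<open>e\<close> coincide with the color of a new pendant vertex. Hence
  there are at most \<open>s n\<^sub>i + 1\<close> colors plus the number of classes other than \<open>V\<^sub>i\<close> with color at
  most \<open>e\<close>: the \<open>t - r\<close> pendant singletons, and those among \<open>V\<^sub>1, \<dots>, V\<^sub>r\<close> below the
  threshold \<open>e\<close>, which the case distinction counts.

  Lower bound (\<open>pendants_lt_num_colors\<close>): in any local antimagic labeling the pendant vertices
  have distinct colors, at most the number of edges, while the non-pendant end of the edge with the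
  largest label has a larger color. So the number of colors exceeds the number of
  pendant vertices. Attaching edges to \<open>V\<^sub>i\<close> creates \<open>s n\<^sub>i\<close> pendant vertices and destroys
  those of \<open>G\<close> in \<open>V\<^sub>i\<close>; there is at most one of these, because \<open>V\<^sub>i\<close> is monochromatic, and none if
  \<open>c\<^sub>i > e\<close>.
\<close>

section \<open>Minima over local antimagic labelings\<close>

lemma chi_la_le:
  "local_antimagic G f \<Longrightarrow> chi_la G \<le> num_colors G f"
  unfolding chi_la_def by (rule wellorder_Inf_le1) blast

lemma chi_la_attained:
  assumes "local_antimagic G f"
  obtains g where "local_antimagic G g" "num_colors G g = chi_la G"
proof -
  have "chi_la G \<in> {num_colors G f | f. local_antimagic G f}"
    unfolding chi_la_def using assms by (intro Inf_nat_def1) blast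
  then show ?thesis using that by auto
qed

section \<open>Pendant vertices and the number of colors\<close>

lemma finite_edges: "simple_graph G \<Longrightarrow> finite (edges G)"
  unfolding simple_graph_def by (rule finite_subset[of _ "Pow (vertices G)"]) auto

lemma finite_incident_edges: "simple_graph G \<Longrightarrow> finite (incident_edges G v)"
  using finite_edges[of G] by (simp add: incident_edges_def)

lemma edge_between:
  assumes "simple_graph G" "\<epsilon> \<in> edges G"
  obtains x y where "\<epsilon> = {x, y}" "x \<noteq> y" "x \<in> vertices G" "y \<in> vertices G"
proof -
  have "card \<epsilon> = 2" "\<epsilon> \<subseteq> vertices G" using assms by (auto simp: simple_graph_def)
  then show ?thesis using that by (auto simp: card_2_iff)
qed

text \<open>A path from \<open>v\<close> to another vertex has to leave \<open>v\<close> along an edge.\<close>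

lemma connected_incident_edges_nonempty:
  assumes "simple_graph G" "connected_graph G" "edges G \<noteq> {}" "v \<in> vertices G"
  shows "incident_edges G v \<noteq> {}"
proof -
  obtain \<epsilon> where "\<epsilon> \<in> edges G" using assms(3) by blast
  then obtain x y where "x \<noteq> y" "x \<in> vertices G" "y \<in> vertices G"
    using edge_between[OF assms(1)] by metis
  then obtain u where u: "u \<in> vertices G" "u \<noteq> v" by metis
  then have "(v, u) \<in> {(x, y). {x, y} \<in> edges G}\<^sup>*"
    using assms by (auto simp: connected_graph_def)
  then obtain w where "{v, w} \<in> edges G"
    using u(2) by (auto elim: converse_rtranclE)
  then show ?thesis by (auto simp: incident_edges_def)
qed

lemma pendant_unique_edge:
  assumes "pendant G v" "\<epsilon> \<in> edges G" "v \<in> \<epsilon>"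
  shows "incident_edges G v = {\<epsilon>}"
proof -
  have "\<epsilon> \<in> incident_edges G v" using assms by (simp add: incident_edges_def)
  moreover obtain \<delta> where "incident_edges G v = {\<delta>}"
    using assms(1) by (auto simp: pendant_def card_1_singleton_iff)
  ultimately show ?thesis by simp
qed

text \<open>An edge with two pendant ends is a whole connected component, which in a connected
  graph leaves no room for a second edge.\<close>

lemma connected_edge_has_nonpendant_end:
  assumes "simple_graph G" "connected_graph G" "card (edges G) \<ge> 2" "\<epsilon> \<in> edges G"
  shows "\<exists>v\<in>\<epsilon>. \<not> pendant G v"
proof (rule ccontr)
  assume "\<not> (\<exists>v\<in>\<epsilon>. \<not> pendant G v)"
  then have inc: "incident_edges G v = {\<epsilon>}" if "v \<in> \<epsilon>" for v
    using that pendant_unique_edge assms(4) by metis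
  obtain u where u: "u \<in> \<epsilon>" "u \<in> vertices G"
    using edge_between[OF assms(1,4)] by blast
  have reach: "w \<in> \<epsilon>" if "(u, w) \<in> {(x, y). {x, y} \<in> edges G}\<^sup>*" for w
    using that
  proof induction
    case base show ?case by (rule u)
  next
    case (step y z)
    then have "{y, z} \<in> incident_edges G y" by (auto simp: incident_edges_def)
    then show ?case using inc step by auto
  qed
  have "edges G \<subseteq> {\<epsilon>}"
  proof
    fix \<delta> assume d: "\<delta> \<in> edges G"
    obtain x y where xy: "\<delta> = {x, y}" "x \<in> vertices G"
      using edge_between[OF assms(1) d] by metis
    then have "x \<in> \<epsilon>" using reach u(2) assms(2) by (auto simp: connected_graph_def)
    then have "incident_edges G x = {\<epsilon>}" by (rule inc)
    moreover have "\<delta> \<in> incident_edges G x" using d xy(1) by (simp add: incident_edges_def)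
    ultimately show "\<delta> \<in> {\<epsilon>}" by simp
  qed
  then have "card (edges G) \<le> 1" using card_mono[of "{\<epsilon>}"] by auto
  then show False using assms(3) by simp
qed

lemma local_antimagic_label_bounds:
  assumes "local_antimagic G f" "\<epsilon> \<in> edges G"
  shows "1 \<le> f \<epsilon>" "f \<epsilon> \<le> card (edges G)"
proof -
  have "f \<epsilon> \<in> {1..card (edges G)}"
    using assms bij_betwE unfolding local_antimagic_def by blast
  then show "1 \<le> f \<epsilon>" "f \<epsilon> \<le> card (edges G)" by simp_all
qed

lemma induced_label_positive:
  assumes "simple_graph G" "local_antimagic G f" "incident_edges G v \<noteq> {}"
  shows "induced_label G f v > 0"
proof -
  obtain \<epsilon> where e: "\<epsilon> \<in> incident_edges G v" using assms(3) by blast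
  then have "f \<epsilon> \<le> induced_label G f v"
    unfolding induced_label_def using finite_incident_edges[OF assms(1)]
    by (intro member_le_sum) auto
  moreover have "1 \<le> f \<epsilon>"
    using e local_antimagic_label_bounds[OF assms(2)] by (auto simp: incident_edges_def)
  ultimately show ?thesis by simp
qed

lemma pendant_label_le:
  assumes "local_antimagic G f" "pendant G v"
  shows "induced_label G f v \<le> card (edges G)"
proof -
  obtain \<epsilon> where "incident_edges G v = {\<epsilon>}"
    using assms(2) by (auto simp: pendant_def card_1_singleton_iff)
  then show ?thesis
    using local_antimagic_label_bounds[OF assms(1), of \<epsilon>]
    by (auto simp: induced_label_def incident_edges_def)
qed

text \<open>The color of a pendant vertex is the label of its edge, and two pendant vertices never
  share an edge.\<close>

lemma inj_on_pendant_labels: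
  assumes "local_antimagic G f" "simple_graph G"
    and nonpend: "\<forall>\<epsilon>\<in>edges G. \<exists>v\<in>\<epsilon>. \<not> pendant G v"
  shows "inj_on (induced_label G f) {v. pendant G v}"
proof (rule inj_onI, clarsimp)
  fix u v assume pu: "pendant G u" and pv: "pendant G v"
    and eq: "induced_label G f u = induced_label G f v"
  obtain \<epsilon> where e: "incident_edges G u = {\<epsilon>}"
    using pu by (auto simp: pendant_def card_1_singleton_iff)
  obtain \<delta> where d: "incident_edges G v = {\<delta>}"
    using pv by (auto simp: pendant_def card_1_singleton_iff)
  have mem: "\<epsilon> \<in> edges G" "u \<in> \<epsilon>" "\<delta> \<in> edges G" "v \<in> \<delta>"
    using e d by (auto simp: incident_edges_def)
  have "f \<epsilon> = f \<delta>" using eq e d by (simp add: induced_label_def)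
  then have "\<epsilon> = \<delta>" using mem assms(1)
    by (auto simp: local_antimagic_def bij_betw_def dest: inj_onD)
  obtain w where w: "w \<in> \<epsilon>" "\<not> pendant G w" using nonpend mem by blast
  obtain x y where "\<epsilon> = {x, y}" using edge_between[OF assms(2) mem(1)] by metis
  then show "u = v" using mem \<open>\<epsilon> = \<delta>\<close> w pu pv by auto
qed

text \<open>The edge with the largest label has an end of degree at least 2. The color of this end
  exceeds all labels, hence all the colors of the pendant vertices, which are distinct labels.\<close>

lemma pendants_lt_num_colors:
  assumes sg: "simple_graph G" and "edges G \<noteq> {}"
    and nonpend: "\<forall>\<epsilon>\<in>edges G. \<exists>v\<in>\<epsilon>. \<not> pendant G v"
    and la: "local_antimagic G f"
  shows "card {v. pendant G v} + 1 \<le> num_colors G f"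
proof -
  let ?m = "card (edges G)" and ?P = "{v. pendant G v}"
  have fin: "finite (vertices G)" using sg by (simp add: simple_graph_def)
  have PV: "?P \<subseteq> vertices G" by (auto simp: pendant_def)
  have "?m \<ge> 1" using finite_edges[OF sg] assms(2) by (simp add: Suc_le_eq card_gt_0_iff)
  then have "?m \<in> f ` edges G" using la by (simp add: local_antimagic_def bij_betw_def)
  then obtain \<epsilon> where e: "\<epsilon> \<in> edges G" "f \<epsilon> = ?m" by auto
  obtain v where v: "v \<in> \<epsilon>" "\<not> pendant G v" using nonpend e by blast
  have vV: "v \<in> vertices G" using sg v e by (auto simp: simple_graph_def)
  have inc: "\<epsilon> \<in> incident_edges G v" using v e by (simp add: incident_edges_def)
  have "incident_edges G v \<noteq> {\<epsilon>}" using v(2) vV by (auto simp: pendant_def)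
  then obtain \<delta> where d: "\<delta> \<in> incident_edges G v" "\<delta> \<noteq> \<epsilon>" using inc by blast
  have "f \<epsilon> + f \<delta> = (\<Sum>x\<in>{\<epsilon>, \<delta>}. f x)" using d by simp
  also have "\<dots> \<le> induced_label G f v"
    unfolding induced_label_def using d inc finite_incident_edges[OF sg]
    by (intro sum_mono2) auto
  finally have big: "induced_label G f v > ?m"
    using e local_antimagic_label_bounds[OF la, of \<delta>] d by (auto simp: incident_edges_def)
  have "card ?P + 1 = card (insert (induced_label G f v) (induced_label G f ` ?P))"
  proof -
    have "induced_label G f v \<notin> induced_label G f ` ?P"
      using big pendant_label_le[OF la] by force
    then show ?thesis
      using finite_subset[OF PV fin] card_image[OF inj_on_pendant_labels[OF la sg nonpend]]
      by simp
  qed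
  also have "\<dots> \<le> num_colors G f"
    unfolding num_colors_def using fin PV vV by (intro card_mono) auto
  finally show ?thesis .
qed

section \<open>Degrees after attaching pendant edges\<close>

lemma vertices_add_pendants:
  "vertices (add_pendants G S s) = Inl ` vertices G \<union> Inr ` (S \<times> {1..s})"
  by (simp add: add_pendants_def)

lemma incident_edges_add_pendants_Inl:
  "incident_edges (add_pendants G S s) (Inl v) =
     (\<lambda>\<epsilon>. Inl ` \<epsilon>) ` incident_edges G v \<union>
     (if v \<in> S then (\<lambda>k. {Inl v, Inr (v, k)}) ` {1..s} else {})"
  by (auto simp: incident_edges_def add_pendants_def)

lemma incident_edges_add_pendants_Inr:
  "v \<in> S \<Longrightarrow> k \<in> {1..s} \<Longrightarrow>
   incident_edges (add_pendants G S s) (Inr (v, k)) = {{Inl v, Inr (v, k)}}"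
  by (auto simp: incident_edges_def add_pendants_def)

lemma inj_image_Inl: "inj ((`) Inl)"
  by (simp add: inj_image_eq_iff inj_def)

lemma inj_on_image_Inl: "inj_on ((`) Inl) A"
  using inj_image_Inl by (rule inj_on_subset) simp

lemma inj_on_new_edge: "inj_on (\<lambda>k. {Inl v, Inr (v, k)}) A"
  by (auto simp: inj_on_def doubleton_eq_iff)

lemma simple_graph_add_pendants:
  assumes "simple_graph G" "S \<subseteq> vertices G"
  shows "simple_graph (add_pendants G S s)"
proof -
  have "finite S" using assms finite_subset by (auto simp: simple_graph_def)
  then show ?thesis using assms
    by (auto simp: simple_graph_def add_pendants_def card_image)
qed

lemma card_incident_edges_add_pendants:
  assumes "simple_graph G"
  shows "card (incident_edges (add_pendants G S s) (Inl v)) =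
           card (incident_edges G v) + (if v \<in> S then s else 0)"
proof -
  have "(\<lambda>\<epsilon>. Inl ` \<epsilon>) ` incident_edges G v \<inter> (\<lambda>k. {Inl v, Inr (v, k)}) ` {1..s} = {}"
    by auto
  then show ?thesis
    by (simp add: incident_edges_add_pendants_Inl card_Un_disjoint card_image
        inj_on_new_edge inj_on_image_Inl finite_incident_edges[OF assms])
qed

text \<open>The vertices of \<open>S\<close> are no longer pendant after the attachment, because they already had an
  edge. So every edge of the new graph still has a non-pendant end, and the bound on the number
  of colors applies to it.\<close>

lemma pendants_lt_num_colors_add_pendants:
  assumes sg: "simple_graph G" and "edges G \<noteq> {}"
    and nonpend: "\<forall>\<epsilon>\<in>edges G. \<exists>v\<in>\<epsilon>. \<not> pendant G v"
    and S: "S \<subseteq> vertices G" and inc: "\<forall>v\<in>S. incident_edges G v \<noteq> {}" and "s \<ge> 1"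
    and la: "local_antimagic (add_pendants G S s) g"
  shows "s * card S + card ({v. pendant G v} - S) + 1 \<le> num_colors (add_pendants G S s) g"
proof -
  let ?H = "add_pendants G S s" and ?P = "{v. pendant G v} - S"
  have sgH: "simple_graph ?H" by (rule simple_graph_add_pendants[OF sg S])
  have finV: "finite (vertices G)" using sg by (simp add: simple_graph_def)
  have finS: "finite S" using finV S finite_subset by blast
  have finP: "finite ?P"
    by (rule finite_subset[OF _ finV]) (auto simp: pendant_def)
  have oldV: "pendant ?H (Inl v) \<Longrightarrow> v \<notin> S \<and> pendant G v" for v
  proof -
    assume p: "pendant ?H (Inl v)"
    then have "v \<in> vertices G" by (auto simp: pendant_def add_pendants_def)
    moreover have "card (incident_edges G v) > 0" if "v \<in> S"
      using inc that finite_incident_edges[OF sg] by (simp add: card_gt_0_iff)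
    ultimately show "v \<notin> S \<and> pendant G v"
      using p \<open>s \<ge> 1\<close> by (auto simp: pendant_def card_incident_edges_add_pendants[OF sg] split: if_splits)
  qed
  have nonpendH: "\<forall>\<epsilon>\<in>edges ?H. \<exists>v\<in>\<epsilon>. \<not> pendant ?H v"
  proof
    fix \<epsilon> assume "\<epsilon> \<in> edges ?H"
    then consider \<delta> where "\<delta> \<in> edges G" "\<epsilon> = Inl ` \<delta>"
      | v k where "v \<in> S" "\<epsilon> = {Inl v, Inr (v, k)}"
      by (auto simp: add_pendants_def)
    then show "\<exists>v\<in>\<epsilon>. \<not> pendant ?H v"
      using nonpend oldV by cases blast+
  qed
  have "Inr ` (S \<times> {1..s}) \<union> Inl ` ?P \<subseteq> {v. pendant ?H v}"
    by (auto simp: pendant_def card_incident_edges_add_pendants[OF sg]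
        incident_edges_add_pendants_Inr vertices_add_pendants)
  then have "card (Inr ` (S \<times> {1..s}) \<union> Inl ` ?P) \<le> card {v. pendant ?H v}"
  proof (rule card_mono[rotated])
    show "finite {v. pendant ?H v}"
      by (rule finite_subset[of _ "vertices ?H"])
         (use sgH in \<open>auto simp: pendant_def simple_graph_def\<close>)
  qed
  moreover have "card (Inr ` (S \<times> {1..s}) \<union> Inl ` ?P) = s * card S + card ?P"
    using finS finP
    by (subst card_Un_disjoint) (auto simp: card_image card_cartesian_product)
  moreover have "edges ?H \<noteq> {}" using assms(2) by (auto simp: add_pendants_def)
  ultimately show ?thesis
    using pendants_lt_num_colors[OF sgH _ nonpendH la] by simp
qed

section \<open>Distributing the new labels\<close>

text \<open>Fill a table with \<open>n\<close> rows and \<open>2 m\<close> columns column by column, downwards in even columns and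
  upwards in odd ones. What a row gains in one column of a pair it loses in the other, so
  all row sums agree.\<close>

lemma snake_row_sum:
  fixes n a :: nat
  assumes "a < n"
  shows "(\<Sum>j<2 * m. j * n + (if even j then a else n - 1 - a) + 1) = m * (2 * m * n + 1)"
proof (induction m)
  case (Suc m)
  have "2 * Suc m = Suc (Suc (2 * m))" by simp
  then show ?case using Suc assms by (simp add: algebra_simps)
qed simp

text \<open>The rows of the table are the vertices of \<open>S\<close>, the columns their new edges. A single row needs
  no pairing of columns, so that \<open>s\<close> may then be odd. The lower bound on the common row sum \<open>C\<close>
  holds because some row contains the largest entry.\<close>

lemma snake_numbering:
  assumes "finite S" "S \<noteq> {}" "s \<ge> 1" "card S = 1 \<or> even s"
  obtains h :: "'a \<times> nat \<Rightarrow> nat" and C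
  where "bij_betw h (S \<times> {1..s}) {1..s * card S}"
    and "\<And>v. v \<in> S \<Longrightarrow> (\<Sum>k\<in>{1..s}. h (v, k)) = C"
    and "s * card S \<le> C"
proof -
  define n where "n = card S"
  have "n > 0" using assms by (simp add: n_def card_gt_0_iff)
  obtain p where p: "bij_betw p S {0..<n}"
    unfolding n_def using ex_bij_betw_finite_nat[OF assms(1)] by blast
  have plt: "p v < n" if "v \<in> S" for v using p that by (auto dest: bij_betwE)
  define q where "q v j = (if even j then p v else n - 1 - p v)" for v and j :: nat
  define h where "h = (\<lambda>(v, k). (k - 1) * n + q v (k - 1) + 1)"
  have qlt: "q v j < n" if "v \<in> S" for v j
    using plt[OF that] \<open>n > 0\<close> by (auto simp: q_def)
  have qinj: "v = w" if "q v j = q w j" "v \<in> S" "w \<in> S" for v w j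
  proof -
    have "p v = p w" using that plt[of v] plt[of w] by (auto simp: q_def split: if_splits)
    then show ?thesis using p that by (auto simp: bij_betw_def dest: inj_onD)
  qed
  have "inj_on h (S \<times> {1..s})"
  proof (rule inj_onI, clarsimp)
    fix v k w l
    assume vw: "v \<in> S" "w \<in> S" and kl: "Suc 0 \<le> k" "Suc 0 \<le> l" and "h (v, k) = h (w, l)"
    then have eq: "(k - 1) * n + q v (k - 1) = (l - 1) * n + q w (l - 1)" by (simp add: h_def)
    have "k - 1 = ((k - 1) * n + q v (k - 1)) div n" "l - 1 = ((l - 1) * n + q w (l - 1)) div n"
      using qlt vw \<open>n > 0\<close> by simp_all
    then have "k - 1 = l - 1" using eq by simp
    then show "v = w \<and> k = l" using qinj[OF _ vw] eq kl by auto
  qed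
  moreover have "h ` (S \<times> {1..s}) \<subseteq> {1..s * n}"
  proof clarsimp
    fix v k assume "v \<in> S" "Suc 0 \<le> k" "k \<le> s"
    have "(k - 1) * n + q v (k - 1) + 1 \<le> (k - 1) * n + n" using qlt[OF \<open>v \<in> S\<close>] by (simp add: Suc_le_eq)
    also have "\<dots> = k * n" using \<open>Suc 0 \<le> k\<close> by (cases k) auto
    also have "\<dots> \<le> s * n" using \<open>k \<le> s\<close> by simp
    finally show "Suc 0 \<le> h (v, k) \<and> h (v, k) \<le> s * n" by (simp add: h_def)
  qed
  ultimately have bij: "bij_betw h (S \<times> {1..s}) {1..s * n}"
    unfolding bij_betw_def
    by (intro conjI card_subset_eq) (simp_all add: card_image card_cartesian_product n_def mult.commute)
  have "\<exists>C. \<forall>v\<in>S. (\<Sum>k\<in>{1..s}. h (v, k)) = C"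
  proof (cases "card S = 1")
    case True
    then show ?thesis by (auto simp: card_1_singleton_iff)
  next
    case False
    then obtain m where m: "s = 2 * m" using assms(4) by (auto elim: evenE)
    have "(\<Sum>k\<in>{1..s}. h (v, k)) = m * (2 * m * n + 1)" if "v \<in> S" for v
    proof -
      have "(\<Sum>k\<in>{1..s}. h (v, k)) = (\<Sum>j<s. h (v, Suc j))"
        by (simp add: sum.atLeast_Suc_atMost_Suc_shift sum.atLeast1_atMost_eq)
      also have "\<dots> = m * (2 * m * n + 1)"
        using snake_row_sum[OF plt[OF that], of m] by (simp add: h_def q_def m)
      finally show ?thesis .
    qed
    then show ?thesis by blast
  qed
  then obtain C where C: "(\<Sum>k\<in>{1..s}. h (v, k)) = C" if "v \<in> S" for v by blast
  have "s * n \<in> h ` (S \<times> {1..s})"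
    using bij \<open>n > 0\<close> assms(3) by (auto simp: bij_betw_def)
  then obtain v k where vk: "v \<in> S" "k \<in> {1..s}" "h (v, k) = s * n" by auto
  have "h (v, k) \<le> (\<Sum>k\<in>{1..s}. h (v, k))"
    using vk(2) by (intro member_le_sum) auto
  then have "s * n \<le> C" using C vk by simp
  then show thesis using that[of h C] bij C by (simp add: n_def)
qed

section \<open>Extending a labeling to the new pendant edges\<close>

text \<open>The vertices outside \<open>S\<close> keep their colors, and those in \<open>S\<close> move to the common color
  \<open>a + s e + C\<close>, with \<open>C\<close> the common row sum of the snake numbering. This exceeds all labels,
  so it differs from the colors of the new pendant vertices and, by the last hypothesis, from
  those of the old neighbours. An old color above \<open>e\<close> is already the color of a new pendant
  vertex and is not counted again.\<close>

lemma extend_labeling: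
  assumes sg: "simple_graph G" and la: "local_antimagic G f"
    and ind: "independent G S" and "S \<noteq> {}"
    and a: "\<forall>v\<in>S. induced_label G f v = a" and "a > 0"
    and "s \<ge> 1" and "card S = 1 \<or> even s"
    and le: "\<forall>v\<in>vertices G - S. induced_label G f v \<le> card (edges G) + s * card S"
  obtains g where "local_antimagic (add_pendants G S s) g"
    and "num_colors (add_pendants G S s) g \<le> s * card S + 1 +
      card {x \<in> induced_label G f ` (vertices G - S). x \<le> card (edges G)}"
proof -
  let ?H = "add_pendants G S s"
  define e where "e = card (edges G)"
  define N where "N = s * card S"
  have SV: "S \<subseteq> vertices G" using ind by (simp add: independent_def)
  have finV: "finite (vertices G)" using sg by (simp add: simple_graph_def)
  have finS: "finite S" using finV SV finite_subset by blast
  obtain h C where h: "bij_betw h (S \<times> {1..s}) {1..N}"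
    and C: "\<And>v. v \<in> S \<Longrightarrow> (\<Sum>k\<in>{1..s}. h (v, k)) = C" and NC: "N \<le> C"
    using snake_numbering[OF finS assms(4,7,8)] unfolding N_def by metis
  \<comment> \<open>An edge is new exactly if it has a new end, and that end identifies it.\<close>
  define g :: "('a + 'a \<times> nat) set \<Rightarrow> nat" where
    "g \<epsilon> = (if \<exists>p. Inr p \<in> \<epsilon> then e + h (THE p. Inr p \<in> \<epsilon>) else f (Inl -` \<epsilon>))" for \<epsilon>
  have g_old: "g (Inl ` \<epsilon>) = f \<epsilon>" for \<epsilon>
    by (auto simp: g_def inj_vimage_image_eq)
  have g_new: "g {Inl v, Inr (w, k)} = e + h (w, k)" for v w k
    by (simp add: g_def)
  define E1 :: "('a + 'a \<times> nat) set set" where "E1 = (`) Inl ` edges G"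
  define E2 :: "('a + 'a \<times> nat) set set" where "E2 = (\<lambda>(v, k). {Inl v, Inr (v, k)}) ` (S \<times> {1..s})"
  have "{{Inl v, Inr (v, k)} | v k. v \<in> S \<and> k \<in> {1..s}} = E2"
    unfolding E2_def image_def Bex_def split_paired_Ex mem_Sigma_iff prod.case by blast
  then have EH: "edges ?H = E1 \<union> E2" by (simp add: add_pendants_def E1_def)
  have b1: "bij_betw g E1 {1..e}"
  proof -
    have "bij_betw (g \<circ> (`) Inl) (edges G) {1..e}"
      using la by (simp add: comp_def g_old local_antimagic_def e_def)
    then show ?thesis
      by (simp add: E1_def bij_betw_comp_iff[OF inj_on_imp_bij_betw[OF inj_on_image_Inl]])
  qed
  have b2: "bij_betw g E2 {e+1..e+N}"
  proof -
    have "bij_betw ((+) e \<circ> h) (S \<times> {1..s}) {e+1..e+N}"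
      by (rule bij_betw_trans[OF h]) (simp add: bij_betw_def)
    then have "bij_betw (g \<circ> (\<lambda>(v, k). {Inl v, Inr (v, k)})) (S \<times> {1..s}) {e+1..e+N}"
      by (rule bij_betw_cong[THEN iffD1, rotated]) (auto simp: g_new)
    moreover have "inj_on (\<lambda>(v, k). {Inl v, Inr (v, k)}) (S \<times> {1..s})"
      by (auto simp: inj_on_def doubleton_eq_iff)
    ultimately show ?thesis
      by (simp add: E2_def bij_betw_comp_iff[OF inj_on_imp_bij_betw])
  qed
  have bij: "bij_betw g (edges ?H) {1..e+N}"
  proof -
    have "bij_betw g (E1 \<union> E2) ({1..e} \<union> {e+1..e+N})"
      by (rule bij_betw_combine[OF b1 b2]) auto
    moreover have "{1..e} \<union> {e+1..e+N} = {1..e+N}" by auto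
    ultimately show ?thesis by (simp add: EH)
  qed
  then have cardH: "card (edges ?H) = e + N" by (simp add: bij_betw_same_card)
  have lab_old: "induced_label ?H g (Inl v) = induced_label G f v + (if v \<in> S then s * e + C else 0)" for v
  proof -
    have old: "(\<Sum>\<epsilon>\<in>(`) Inl ` incident_edges G v. g \<epsilon>) = induced_label G f v"
      by (simp add: sum.reindex inj_on_image_Inl g_old induced_label_def)
    have new: "(\<Sum>\<epsilon>\<in>(\<lambda>k. {Inl v, Inr (v, k)}) ` {1..s}. g \<epsilon>) = s * e + C" if "v \<in> S"
      using C[OF that] by (simp add: sum.reindex inj_on_new_edge g_new sum.distrib)
    show ?thesis
    proof (cases "v \<in> S")
      case True
      have "induced_label ?H g (Inl v) = (\<Sum>\<epsilon>\<in>(`) Inl ` incident_edges G v. g \<epsilon>) +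
          (\<Sum>\<epsilon>\<in>(\<lambda>k. {Inl v, Inr (v, k)}) ` {1..s}. g \<epsilon>)"
        unfolding induced_label_def incident_edges_add_pendants_Inl if_P[OF True]
        by (rule sum.union_disjoint) (auto simp: finite_incident_edges[OF sg])
      then show ?thesis using True by (simp only: old new if_True)
    next
      case False
      then show ?thesis using old
        by (simp add: induced_label_def[of ?H] incident_edges_add_pendants_Inl)
    qed
  qed
  have lab_S: "induced_label ?H g (Inl v) = a + s * e + C" if "v \<in> S" for v
    using that a by (simp add: lab_old)
  have lab_new: "induced_label ?H g (Inr (v, k)) = e + h (v, k)" if "v \<in> S" "k \<in> {1..s}" for v k
    unfolding induced_label_def incident_edges_add_pendants_Inr[OF that] by (simp add: g_new)
  have hle: "h (v, k) \<in> {1..N}" if "v \<in> S" "k \<in> {1..s}" for v k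
    using h that by (auto dest!: bij_betwE)
  have "e \<le> s * e" using assms(7) by simp
  then have big: "e + N < a + s * e + C" using NC \<open>a > 0\<close> by linarith
  have noS: "{x, y} \<notin> edges G" if "x \<in> S" "y \<in> S" for x y
    using ind that by (auto simp: independent_def)
  have le': "induced_label G f v \<le> e + N" if "v \<in> vertices G" "v \<notin> S" for v
    using le that by (simp add: e_def N_def)
  have edgeV: "x \<in> vertices G" "y \<in> vertices G" if "{x, y} \<in> edges G" for x y
    using sg that by (auto simp: simple_graph_def)
  have proper_old: "induced_label ?H g (Inl x) \<noteq> induced_label ?H g (Inl y)"
    if xy: "{x, y} \<in> edges G" for x y
  proof (cases "x \<in> S"; cases "y \<in> S")
    assume "x \<in> S" "y \<in> S" then show ?thesis using noS xy by blast
  next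
    assume "x \<in> S" "y \<notin> S"
    then show ?thesis using lab_S[of x] lab_old[of y] le'[of y] edgeV[OF xy] big by simp
  next
    assume "x \<notin> S" "y \<in> S"
    then show ?thesis using lab_S[of y] lab_old[of x] le'[of x] edgeV[OF xy] big by simp
  next
    assume "x \<notin> S" "y \<notin> S"
    then show ?thesis using la xy lab_old by (simp add: local_antimagic_def)
  qed
  have proper_new: "induced_label ?H g (Inr (v, k)) < induced_label ?H g (Inl v)"
    if "v \<in> S" "k \<in> {1..s}" for v k
    using lab_new[OF that] hle[OF that] lab_S[OF that(1)] big by simp
  have "local_antimagic ?H g"
    unfolding local_antimagic_def cardH
  proof (intro conjI allI impI bij)
    fix x y assume "{x, y} \<in> edges ?H"
    then consider \<epsilon> where "\<epsilon> \<in> edges G" "{x, y} = Inl ` \<epsilon>"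
      | v k where "v \<in> S" "k \<in> {1..s}" "{x, y} = {Inl v, Inr (v, k)}"
      by (auto simp: add_pendants_def)
    then show "induced_label ?H g x \<noteq> induced_label ?H g y"
    proof cases
      case 1
      then have "x \<in> Inl ` \<epsilon>" "y \<in> Inl ` \<epsilon>" by auto
      then obtain u v where uv: "x = Inl u" "y = Inl v" by auto
      then have "(Inl ` {u, v} :: ('a + 'a \<times> nat) set) = Inl ` \<epsilon>" using 1 by simp
      then have "{u, v} = \<epsilon>" using inj_image_Inl by (rule injD[rotated])
      then show ?thesis using proper_old 1 uv by simp
    next
      case 2
      then show ?thesis using proper_new[OF 2(1,2)] by (auto simp: doubleton_eq_iff)
    qed
  qed
  moreover have "num_colors ?H g \<le> N + 1 + card {x \<in> induced_label G f ` (vertices G - S). x \<le> e}"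
  proof -
    let ?D = "{x \<in> induced_label G f ` (vertices G - S). x \<le> e}"
    have "induced_label ?H g ` vertices ?H \<subseteq> {e+1..e+N} \<union> {a + s * e + C} \<union> ?D"
    proof (rule image_subsetI)
      fix x assume "x \<in> vertices ?H"
      then consider v where "x = Inl v" "v \<in> S" | v where "x = Inl v" "v \<in> vertices G" "v \<notin> S"
        | v k where "x = Inr (v, k)" "v \<in> S" "k \<in> {1..s}"
        by (auto simp: add_pendants_def)
      then show "induced_label ?H g x \<in> {e+1..e+N} \<union> {a + s * e + C} \<union> ?D"
      proof cases
        case 1 then show ?thesis using lab_S by simp
      next
        case 2
        then show ?thesis using le'[of v] by (cases "induced_label G f v \<le> e") (auto simp: lab_old)
      next
        case 3 then show ?thesis using lab_new hle by force
      qed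
    qed
    then have "num_colors ?H g \<le> card ({e+1..e+N} \<union> {a + s * e + C} \<union> ?D)"
      unfolding num_colors_def using finV by (intro card_mono) auto
    also have "\<dots> \<le> card ({e+1..e+N} \<union> {a + s * e + C}) + card ?D"
      by (rule card_Un_le)
    also have "\<dots> \<le> card {e+1..e+N} + card {a + s * e + C} + card ?D"
      by (intro add_right_mono card_Un_le)
    finally show ?thesis by simp
  qed
  ultimately show thesis using that by (simp add: e_def N_def)
qed

section \<open>Attaching pendant edges to a color class\<close>

theorem theorem2p1:
  fixes G :: "'a ugraph" and f :: "'a set \<Rightarrow> nat"
    and Vs :: "nat \<Rightarrow> 'a set" and n c :: "nat \<Rightarrow> nat"
    and e t r b :: nat
  assumes "simple_graph G" and "connected_graph G"
    and "e = card (edges G)" and "e \<ge> 2"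
    and "chi_la G = t" and "t \<ge> 2"
    and "local_antimagic G f" and "num_colors G f = t"
    and "(\<Union>i\<in>{1..t}. Vs i) = vertices G" and "disjoint_family_on Vs {1..t}"
    and "\<forall>i\<in>{1..t}. independent G (Vs i)"
    and "\<forall>i\<in>{1..t}. card (Vs i) = n i \<and> n i \<ge> 1"
    and "\<forall>i\<in>{1..t}. \<forall>v\<in>Vs i. induced_label G f v = c i"
    and "inj_on c {1..t}"
    and "1 \<le> r" and "r \<le> t"
    and "\<forall>v\<in>vertices G. \<not> pendant G v \<longrightarrow> (\<exists>i\<in>{1..r}. v \<in> Vs i)"
    and "\<forall>i\<in>{r+1..t}. \<exists>v. Vs i = {v} \<and> pendant G v"
    and "strict_mono_on {1..r} c" and "strict_mono_on {r+1..t} c"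
    and "b = card {v \<in> (\<Union>i\<in>{1..r}. Vs i). pendant G v}"
    and "r \<ge> 2"
  shows
    "(e < c 1 \<longrightarrow>
        (\<forall>i\<in>{1..r}. \<forall>s. admissible e n c r i s \<longrightarrow>
           chi_la (add_pendants G (Vs i) s) = s * n i + (t - r) + 1))
   \<and> (c 1 \<le> e \<and> e < c 2 \<longrightarrow>
        (\<forall>s. admissible e n c r 1 s \<longrightarrow>
           chi_la (add_pendants G (Vs 1) s) = s * n 1 + (t - r) + 1)
      \<and> (\<forall>i\<in>{2..r}. \<forall>s. admissible e n c r i s \<longrightarrow>
           s * n i + (t - r) + b + 1 \<le> chi_la (add_pendants G (Vs i) s)
         \<and> chi_la (add_pendants G (Vs i) s) \<le> s * n i + (t - r) + 2)
      \<and> (c 1 = e \<and> b = 1 \<longrightarrow>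
          (\<forall>i\<in>{2..r}. \<forall>s. admissible e n c r i s \<longrightarrow>
             chi_la (add_pendants G (Vs i) s) = s * n i + (t - r) + 2)))
   \<and> (\<forall>j\<in>{3..r}. c (j - 1) \<le> e \<and> e < c j \<longrightarrow>
        (\<forall>i\<in>{1..j-1}. \<forall>s. admissible e n c r i s \<and> (\<exists>v\<in>Vs i. pendant G v) \<longrightarrow>
           s * n i + (t - r) + b \<le> chi_la (add_pendants G (Vs i) s)
         \<and> chi_la (add_pendants G (Vs i) s) \<le> s * n i + (t - r) + (j - 1))
      \<and> (\<forall>i\<in>{1..j-1}. \<forall>s. admissible e n c r i s \<and> \<not> (\<exists>v\<in>Vs i. pendant G v) \<longrightarrow>
           s * n i + (t - r) + b + 1 \<le> chi_la (add_pendants G (Vs i) s)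
         \<and> chi_la (add_pendants G (Vs i) s) \<le> s * n i + (t - r) + (j - 1))
      \<and> (\<forall>i\<in>{j..r}. \<forall>s. admissible e n c r i s \<longrightarrow>
           s * n i + (t - r) + b + 1 \<le> chi_la (add_pendants G (Vs i) s)
         \<and> chi_la (add_pendants G (Vs i) s) \<le> s * n i + (t - r) + j)
      \<and> (c (j - 1) = e \<and> b = j - 1 \<longrightarrow>
          (\<forall>i\<in>{1..j-1}. \<forall>s. admissible e n c r i s \<longrightarrow>
             chi_la (add_pendants G (Vs i) s) = s * n i + (t - r) + (j - 1))
        \<and> (\<forall>i\<in>{j..r}. \<forall>s. admissible e n c r i s \<longrightarrow>
             chi_la (add_pendants G (Vs i) s) = s * n i + (t - r) + j)))
   \<and> (c (r - 1) \<le> e \<and> e < c r \<longrightarrow>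
        (\<forall>s. admissible e n c r r s \<longleftrightarrow> size_parity (n r) s))"
proof -
  note sg = assms(1) and conn = assms(2) and e_def = assms(3) and e2 = assms(4) and la = assms(7)
    and cover = assms(9) and disj = assms(10) and ind = assms(11) and card_Vs = assms(12)
    and color = assms(13) and nonpend_Vs = assms(17) and single = assms(18) and mono = assms(19)
    and b_def = assms(21)
  define P where "P = {v. pendant G v}"
  define p where "p i = card {v \<in> Vs i. pendant G v}" for i
  have finV: "finite (vertices G)" using sg by (simp add: simple_graph_def)
  have PV: "P \<subseteq> vertices G" by (auto simp: P_def pendant_def)
  have finP: "finite P" using PV finV finite_subset by blast
  have ne: "edges G \<noteq> {}" using e2 e_def by auto
  have nonpend: "\<forall>\<epsilon>\<in>edges G. \<exists>v\<in>\<epsilon>. \<not> pendant G v"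
    using connected_edge_has_nonpendant_end[OF sg conn] e2 e_def by simp
  have inc: "incident_edges G v \<noteq> {}" if "v \<in> vertices G" for v
    using connected_incident_edges_nonempty[OF sg conn ne that] .
  have Vs_sub: "Vs i \<subseteq> vertices G" if "i \<in> {1..t}" for i using cover that by blast
  have finVs: "finite (Vs i)" if "i \<in> {1..t}" for i using Vs_sub[OF that] finV finite_subset by blast
  have mono': "c k < c l" if "k < l" "1 \<le> k" "l \<le> r" for k l
    using mono that by (auto simp: strict_mono_on_def)

  have pendant_color: "c i \<le> e" if "v \<in> Vs i" "pendant G v" "i \<in> {1..t}" for v i
    using pendant_label_le[OF la that(2)] color that by (simp add: e_def)
  \<comment> \<open>Pendant vertices have distinct colors, whereas a class has only one color.\<close>
  have p_le_1: "p i \<le> 1" if i: "i \<in> {1..t}" for i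
  proof -
    have "u = v" if "u \<in> Vs i" "pendant G u" "v \<in> Vs i" "pendant G v" for u v
      using inj_onD[OF inj_on_pendant_labels[OF la sg nonpend], of u v] that color i by simp
    then show ?thesis using finVs[OF i] by (auto simp: p_def card_le_Suc0_iff_eq)
  qed
  have p_0: "p i = 0" if "\<not> (\<exists>v\<in>Vs i. pendant G v)" for i
  proof -
    have "{v \<in> Vs i. pendant G v} = {}" using that by blast
    then show ?thesis by (simp only: p_def card.empty)
  qed
  have p_0_above: "p i = 0" if "e < c i" "i \<in> {1..t}" for i
    using p_0 pendant_color that by fastforce
  have p_le_b: "p i \<le> b" if "i \<in> {1..r}" for i
    unfolding p_def b_def
    by (rule card_mono) (use that finVs assms(16) in auto)

  have card_P: "card P = (t - r) + b"
  proof -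
    let ?P1 = "{v \<in> (\<Union>i\<in>{1..r}. Vs i). pendant G v}" and ?P2 = "\<Union>i\<in>{r+1..t}. Vs i"
    have "P \<subseteq> ?P1 \<union> ?P2"
    proof
      fix v assume v: "v \<in> P"
      then have "v \<in> (\<Union>i\<in>{1..t}. Vs i)" using PV cover by auto
      then obtain i where i: "i \<in> {1..t}" "v \<in> Vs i" by auto
      show "v \<in> ?P1 \<union> ?P2"
        using v i by (cases "i \<le> r") (auto simp: P_def)
    qed
    moreover have "?P2 \<subseteq> P" using single by (force simp: P_def)
    ultimately have "P = ?P1 \<union> ?P2" by (auto simp: P_def)
    moreover have "?P1 \<inter> ?P2 = {}"
    proof -
      have "Vs i \<inter> Vs k = {}" if "i \<in> {1..r}" "k \<in> {r+1..t}" for i k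
        using disj that assms(16) by (intro disjoint_family_onD) auto
      then show ?thesis by blast
    qed
    moreover have "card ?P2 = t - r"
    proof -
      have "card ?P2 = (\<Sum>i\<in>{r+1..t}. card (Vs i))"
        using disj single by (intro card_UN_disjoint') (auto simp: disjoint_family_on_def intro: finVs)
      also have "\<dots> = (\<Sum>i\<in>{r+1..t}. 1)" by (rule sum.cong) (use single in fastforce)+
      finally show ?thesis by simp
    qed
    moreover have "finite ?P1" "finite ?P2" using finVs assms(16) by auto
    ultimately show ?thesis by (simp add: card_Un_disjoint b_def)
  qed
  have card_P_diff: "card (P - Vs i) + p i = (t - r) + b" if "i \<in> {1..t}" for i
  proof -
    have "{v \<in> Vs i. pendant G v} = P \<inter> Vs i" by (auto simp: P_def)
    then show ?thesis using card_P card_Int_Diff[OF finP, of "Vs i"] by (simp add: p_def)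
  qed

  \<comment> \<open>All parts of the theorem but the last are read off these two inequalities: it only remains to bound
    the number \<open>p i\<close> of pendant vertices that the class loses, and to count the classes with
    color at most \<open>e\<close>.\<close>
  have bounds:
    "s * n i + (t - r) + b + 1 \<le> chi_la (add_pendants G (Vs i) s) + p i"
    "chi_la (add_pendants G (Vs i) s) \<le> s * n i + (t - r) + 1 + card {k \<in> {1..r} - {i}. c k \<le> e}"
    if i: "i \<in> {1..r}" and adm: "admissible e n c r i s" for i s
  proof -
    let ?H = "add_pendants G (Vs i) s"
    have it: "i \<in> {1..t}" using i assms(16) by simp
    have ni: "card (Vs i) = n i" "n i \<ge> 1" using card_Vs it by auto
    have s: "s \<ge> 1" "card (Vs i) = 1 \<or> even s"
      using adm ni by (auto simp: admissible_def size_parity_def)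
    have Vne: "Vs i \<noteq> {}" using ni by auto
    have "c i > 0"
      using induced_label_positive[OF sg la inc] Vne Vs_sub[OF it] color it by fastforce
    have other: "\<exists>k\<in>{1..t} - {i}. v \<in> Vs k \<and> induced_label G f v = c k"
      if "v \<in> vertices G - Vs i" for v
    proof -
      have "v \<in> (\<Union>i\<in>{1..t}. Vs i)" using cover that by simp
      then show ?thesis using color that by blast
    qed
    \<comment> \<open>Among \<open>V\<^sub>1, \<dots>, V\<^sub>r\<close> the largest color other than \<open>c i\<close> is \<open>c r\<close>, or \<open>c (r - 1)\<close> if
      \<open>i = r\<close>; the remaining classes are pendant and have color at most \<open>e\<close>.\<close>
    have "c k \<le> e + s * n i" if "k \<in> {1..t} - {i}" for k
    proof (cases "k \<le> r")
      case True
      have "c k \<le> (if i < r then c r else c (r - 1))"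
      proof (cases "i < r")
        case True
        then show ?thesis using mono'[of k r] \<open>k \<le> r\<close> that by (cases "k = r") auto
      next
        case False
        then have "k \<le> r - 1" using \<open>k \<le> r\<close> that i by auto
        then show ?thesis using mono'[of k "r - 1"] that False by (cases "k = r - 1") auto
      qed
      then show ?thesis using adm by (simp add: admissible_def)
    next
      case False
      then have "k \<in> {r+1..t}" using that by auto
      then obtain v where "Vs k = {v}" "pendant G v" using single by blast
      then show ?thesis using pendant_color[of v k] that by simp
    qed
    then have le: "\<forall>v\<in>vertices G - Vs i. induced_label G f v \<le> card (edges G) + s * card (Vs i)"
      using other ni e_def by fastforce
    obtain g where g: "local_antimagic ?H g"
      and num_g: "num_colors ?H g \<le> s * card (Vs i) + 1 +
        card {x \<in> induced_label G f ` (vertices G - Vs i). x \<le> card (edges G)}"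
      by (rule extend_labeling[OF sg la _ Vne _ \<open>c i > 0\<close> s le]) (use ind color it in auto)
    have "{x \<in> induced_label G f ` (vertices G - Vs i). x \<le> card (edges G)}
        \<subseteq> c ` ({r+1..t} \<union> {k \<in> {1..r} - {i}. c k \<le> e})"
      using other by (fastforce simp: e_def)
    then have "card {x \<in> induced_label G f ` (vertices G - Vs i). x \<le> card (edges G)}
        \<le> card ({r+1..t} \<union> {k \<in> {1..r} - {i}. c k \<le> e})"
      by (intro surj_card_le) auto
    also have "\<dots> \<le> card {r+1..t} + card {k \<in> {1..r} - {i}. c k \<le> e}"
      by (rule card_Un_le)
    finally show "chi_la ?H \<le> s * n i + (t - r) + 1 + card {k \<in> {1..r} - {i}. c k \<le> e}"
      using num_g chi_la_le[OF g] ni by simp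
    obtain g' where g': "local_antimagic ?H g'" "num_colors ?H g' = chi_la ?H"
      using chi_la_attained[OF g] .
    have "s * card (Vs i) + card (P - Vs i) + 1 \<le> num_colors ?H g'"
      unfolding P_def using inc Vs_sub[OF it]
      by (intro pendants_lt_num_colors_add_pendants[OF sg ne nonpend _ _ s(1) g'(1)]) auto
    then show "s * n i + (t - r) + b + 1 \<le> chi_la ?H + p i"
      unfolding ni(1) using card_P_diff[OF it] g'(2) by linarith
  qed

  \<comment> \<open>If \<open>e < c j\<close>, the classes among \<open>V\<^sub>1, \<dots>, V\<^sub>r\<close> with color at most \<open>e\<close> are among the
    first \<open>j - 1\<close>; when \<open>i < j\<close>, one of these is \<open>V\<^sub>i\<close> itself and is not counted.\<close>
  have small_colors: "card {k \<in> {1..r} - {i}. c k \<le> e} \<le> card ({1..<j} - {i})"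
    if "j \<in> {1..r}" "e < c j" for i j
  proof (rule card_mono)
    show "{k \<in> {1..r} - {i}. c k \<le> e} \<subseteq> {1..<j} - {i}"
    proof clarsimp
      fix k assume k: "k \<le> r" "c k \<le> e"
      show "k < j"
        using mono'[of j k] k that by (cases "j = k") (force simp: not_less)+
    qed
  qed simp
  have above: "e < c i" if "j \<in> {1..r}" "e < c j" "i \<in> {j..r}" for i j
    using mono'[of j i] that by (cases "i = j") auto
  have upper_below:
    "chi_la (add_pendants G (Vs i) s) \<le> s * n i + (t - r) + (j - 1)"
    if "j \<in> {1..r}" "e < c j" "i \<in> {1..j-1}" "admissible e n c r i s" for i j s
  proof -
    have card: "card ({1..<j} - {i}) = j - 2" using that(3) by (subst card_Diff_singleton) auto
    have i: "i \<in> {1..r}" and "j \<ge> 2" using that by auto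
    show ?thesis
      using bounds(2)[OF i that(4)] small_colors[OF that(1,2), of i] card \<open>j \<ge> 2\<close> by linarith
  qed
  have upper_above:
    "chi_la (add_pendants G (Vs i) s) \<le> s * n i + (t - r) + j"
    if "j \<in> {1..r}" "e < c j" "i \<in> {j..r}" "admissible e n c r i s" for i j s
  proof -
    have "{1..<j} - {i} = {1..<j}" using that(3) by auto
    then have card: "card ({1..<j} - {i}) = j - 1" by simp
    have i: "i \<in> {1..r}" and "j \<ge> 1" using that by auto
    show ?thesis
      using bounds(2)[OF i that(4)] small_colors[OF that(1,2), of i] card \<open>j \<ge> 1\<close> by linarith
  qed
  have lower_no_pendant:
    "s * n i + (t - r) + b + 1 \<le> chi_la (add_pendants G (Vs i) s)"
    if "i \<in> {1..r}" "admissible e n c r i s" "p i = 0" for i s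
    using bounds(1)[OF that(1,2)] that(3) by simp
  have lower_above:
    "s * n i + (t - r) + b + 1 \<le> chi_la (add_pendants G (Vs i) s)"
    if "j \<in> {1..r}" "e < c j" "i \<in> {j..r}" "admissible e n c r i s" for i j s
    using lower_no_pendant[of i s] p_0_above[of i] above[OF that(1-3)] that assms(16) by auto
  have lower:
    "s * n i + (t - r) + b \<le> chi_la (add_pendants G (Vs i) s)"
    "s * n i + (t - r) + 1 \<le> chi_la (add_pendants G (Vs i) s)"
    if "i \<in> {1..r}" "admissible e n c r i s" for i s
    using bounds(1)[OF that] p_le_1[of i] p_le_b[OF that(1)] that assms(16) by auto

  \<comment> \<open>The first two parts are the thresholds \<open>j = 1\<close> and \<open>j = 2\<close> of the general bounds.\<close>
  have part1: "chi_la (add_pendants G (Vs i) s) = s * n i + (t - r) + 1"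
    if "e < c 1" "i \<in> {1..r}" "admissible e n c r i s" for i s
    using upper_above[of 1 i s] lower(2)[of i s] that by auto
  have part2_1: "chi_la (add_pendants G (Vs 1) s) = s * n 1 + (t - r) + 1"
    if "e < c 2" "admissible e n c r 1 s" for s
    using upper_below[of 2 1 s] lower(2)[of 1 s] that assms(22) by auto
  have part_above:
    "s * n i + (t - r) + b + 1 \<le> chi_la (add_pendants G (Vs i) s) \<and>
     chi_la (add_pendants G (Vs i) s) \<le> s * n i + (t - r) + j"
    if "e < c j" "j \<in> {1..r}" "i \<in> {j..r}" "admissible e n c r i s" for i j s
    using upper_above[of j i s] lower_above[of j i s] that by blast
  have part2_2:
    "s * n i + (t - r) + b + 1 \<le> chi_la (add_pendants G (Vs i) s) \<and>
     chi_la (add_pendants G (Vs i) s) \<le> s * n i + (t - r) + 2"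
    if "e < c 2" "i \<in> {2..r}" "admissible e n c r i s" for i s
    using part_above[of 2 i s] that assms(22) by auto
  have part3_a:
    "s * n i + (t - r) + b \<le> chi_la (add_pendants G (Vs i) s) \<and>
     chi_la (add_pendants G (Vs i) s) \<le> s * n i + (t - r) + (j - 1)"
    if "e < c j" "j \<in> {3..r}" "i \<in> {1..j-1}" "admissible e n c r i s" for i j s
    using upper_below[of j i s] lower(1)[of i s] that by auto
  have part3_b:
    "s * n i + (t - r) + b + 1 \<le> chi_la (add_pendants G (Vs i) s)"
    if "j \<in> {3..r}" "i \<in> {1..j-1}" "admissible e n c r i s" "\<not> (\<exists>v\<in>Vs i. pendant G v)" for i j s
    using lower_no_pendant[of i s] p_0[OF that(4)] that by auto
  have part3_c:
    "s * n i + (t - r) + b + 1 \<le> chi_la (add_pendants G (Vs i) s) \<and>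
     chi_la (add_pendants G (Vs i) s) \<le> s * n i + (t - r) + j"
    if "e < c j" "j \<in> {3..r}" "i \<in> {j..r}" "admissible e n c r i s" for i j s
    using part_above[of j i s] that by auto
  have part4: "admissible e n c r r s \<longleftrightarrow> size_parity (n r) s" if "c (r - 1) \<le> e" for s
    using that by (auto simp: admissible_def)

  show ?thesis
  proof (intro conjI impI ballI allI)
    fix i s assume "e < c 1" "i \<in> {1..r}" "admissible e n c r i s"
    then show "chi_la (add_pendants G (Vs i) s) = s * n i + (t - r) + 1" by (rule part1)
  next
    fix s assume "c 1 \<le> e \<and> e < c 2" "admissible e n c r 1 s"
    then show "chi_la (add_pendants G (Vs 1) s) = s * n 1 + (t - r) + 1" using part2_1 by blast
  next
    fix i s assume "c 1 \<le> e \<and> e < c 2" "i \<in> {2..r}" "admissible e n c r i s"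
    then show "s * n i + (t - r) + b + 1 \<le> chi_la (add_pendants G (Vs i) s)"
      and "chi_la (add_pendants G (Vs i) s) \<le> s * n i + (t - r) + 2"
      using part2_2 by blast+
  next
    fix i s assume "c 1 \<le> e \<and> e < c 2" "c 1 = e \<and> b = 1" "i \<in> {2..r}" "admissible e n c r i s"
    then show "chi_la (add_pendants G (Vs i) s) = s * n i + (t - r) + 2"
      using part2_2[of i s] by simp
  next
    fix j i s assume "j \<in> {3..r}" "c (j - 1) \<le> e \<and> e < c j" "i \<in> {1..j-1}"
      "admissible e n c r i s \<and> (\<exists>v\<in>Vs i. pendant G v)"
    then show "s * n i + (t - r) + b \<le> chi_la (add_pendants G (Vs i) s)"
      and "chi_la (add_pendants G (Vs i) s) \<le> s * n i + (t - r) + (j - 1)"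
      using part3_a by blast+
  next
    fix j i s assume "j \<in> {3..r}" "c (j - 1) \<le> e \<and> e < c j" "i \<in> {1..j-1}"
      "admissible e n c r i s \<and> \<not> (\<exists>v\<in>Vs i. pendant G v)"
    then show "s * n i + (t - r) + b + 1 \<le> chi_la (add_pendants G (Vs i) s)"
      and "chi_la (add_pendants G (Vs i) s) \<le> s * n i + (t - r) + (j - 1)"
      using part3_a part3_b by blast+
  next
    fix j i s assume "j \<in> {3..r}" "c (j - 1) \<le> e \<and> e < c j" "i \<in> {j..r}" "admissible e n c r i s"
    then show "s * n i + (t - r) + b + 1 \<le> chi_la (add_pendants G (Vs i) s)"
      and "chi_la (add_pendants G (Vs i) s) \<le> s * n i + (t - r) + j"
      using part3_c by blast+
  next
    fix j i s assume "j \<in> {3..r}" "c (j - 1) \<le> e \<and> e < c j" "c (j - 1) = e \<and> b = j - 1"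
      "i \<in> {1..j-1}" "admissible e n c r i s"
    then show "chi_la (add_pendants G (Vs i) s) = s * n i + (t - r) + (j - 1)"
      using part3_a[of j i s] by simp
  next
    fix j i s assume "j \<in> {3..r}" "c (j - 1) \<le> e \<and> e < c j" "c (j - 1) = e \<and> b = j - 1"
      "i \<in> {j..r}" "admissible e n c r i s"
    then show "chi_la (add_pendants G (Vs i) s) = s * n i + (t - r) + j"
      using part3_c[of j i s] by auto
  next
    fix s assume "c (r - 1) \<le> e \<and> e < c r"
    then show "admissible e n c r r s \<longleftrightarrow> size_parity (n r) s" using part4 by blast
  qed
qed

end
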